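(* Let $\{U_k\}_{k\ge1}$ be a sequence of i.i.d., bounded, real-valued random variables on a probability space $(\Omega,\mathcal{F},\mathbb{P})$, in $L^2(\Omega,\mathcal{F},\mathbb{P})$, with a symmetric distribution around their mean value. Assume that $|U_1-\mathbb{E}[U_1]|\le d$ almost surely for some $d>0$, and that $\operatorname{Var}(U_1)\le\gamma d^2$ for some $\gamma\in(0,1]$. Let $S_n=\sum_{k=1}^nU_k$ for every integer $n\ge1$. Then, for every $\alpha\ge0$ and every integer $n\ge1$, $$\mathbb{P}\Big(\max_{1\le k\le n}\big|S_k-k\,\mathbb{E}(U_1)\big|\ge\alpha n\Big)\le2\exp\big(-nE(\gamma,\delta)\big),$$ where $\delta=\alpha/d$ and $E(\gamma,\delta)$ is the function defined in the context.
   Context: For $\gamma\in(0,1]$ and $\delta\in[0,1)$ define $$E(\gamma,\delta)=\delta x-\ln\big(1+\gamma[\cosh(x)-1]\big),\qquad x=\ln\left(\frac{\delta(1-\gamma)+\sqrt{\delta^2(1-\gamma)^2+\gamma^2(1-\delta^2)}}{\gamma(1-\delta)}\right).$$ Moreover $E(\gamma,1)=\ln(2/\gamma)$, and $E(\gamma,\delta)=+\infty$ for $\delta>1$, with the convention $\exp(-\infty)=0$. *)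

theory Defs
  imports "HOL-Probability.Probability"
begin

text \<open>Real exponential extended by \<open>exp (-\<infinity>) = 0\<close> and \<open>exp \<infinity> = \<infinity>\<close>.\<close>

definition exp_ereal :: "ereal \<Rightarrow> ereal" where
  "exp_ereal x = (case x of ereal r \<Rightarrow> ereal (exp r) | PInfty \<Rightarrow> \<infinity> | MInfty \<Rightarrow> 0)"

definition x_opt :: "real \<Rightarrow> real \<Rightarrow> real" where
  "x_opt \<gamma> \<delta> =
     ln ((\<delta> * (1 - \<gamma>) + sqrt (\<delta>\<^sup>2 * (1 - \<gamma>)\<^sup>2 + \<gamma>\<^sup>2 * (1 - \<delta>\<^sup>2))) / (\<gamma> * (1 - \<delta>)))"

text \<open>Meaningful for \<open>0 < \<gamma> \<le> 1\<close> and \<open>0 \<le> \<delta>\<close> only; values elsewhere are irrelevant.\<close>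

definition rate_E :: "real \<Rightarrow> real \<Rightarrow> ereal" where
  "rate_E \<gamma> \<delta> =
     (if \<delta> < 1 then ereal (\<delta> * x_opt \<gamma> \<delta> - ln (1 + \<gamma> * (cosh (x_opt \<gamma> \<delta>) - 1)))
      else if \<delta> = 1 then ereal (ln (2 / \<gamma>))
      else \<infinity>)"

definition symmetric_around_mean :: "'a measure \<Rightarrow> ('a \<Rightarrow> real) \<Rightarrow> bool" where
  "symmetric_around_mean M X \<longleftrightarrow>
     distr M borel (\<lambda>\<omega>. X \<omega> - (\<integral>\<omega>'. X \<omega>' \<partial>M)) = distr M borel (\<lambda>\<omega>. (\<integral>\<omega>'. X \<omega>' \<partial>M) - X \<omega>)"

end

theory Submission
  imports Defs
begin

text \<open>
  Centre the variables: \<open>X\<^sub>i = U\<^sub>i - \<mu>\<close> is symmetric, bounded by \<open>d\<close> and of variance at most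
  \<open>\<gamma> d\<^sup>2\<close>. Let \<open>S\<^sub>k\<close> be their partial sums. For every \<open>t \<ge> 0\<close> the process \<open>cosh (t S\<^sub>k)\<close> is a
  submartingale: by the addition theorem
  \<open>cosh (t S\<^sub>k\<^sub>+\<^sub>1) = cosh (t S\<^sub>k) cosh (t X\<^sub>k\<^sub>+\<^sub>1) + sinh (t S\<^sub>k) sinh (t X\<^sub>k\<^sub>+\<^sub>1)\<close>, where the second
  product has conditional mean \<open>0\<close> by symmetry and \<open>cosh (t X\<^sub>k\<^sub>+\<^sub>1)\<close> has mean at least \<open>1\<close>.
  Since \<open>cosh\<close> is even, Doob's maximal inequality for this process controls \<open>\<bar>S\<^sub>k\<bar>\<close>, hence both
  tails at once, and gives
  \<open>P (max \<bar>S\<^sub>k\<bar> \<ge> a) cosh (t a) \<le> E cosh (t S\<^sub>n) = \<Prod>\<^sub>i E cosh (t X\<^sub>i)\<close>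
  (\<open>maximal_inequality_cosh\<close>, \<open>expectation_cosh_S\<close>). The factor \<open>2\<close> of the final estimate is the one
  in \<open>exp y \<le> 2 cosh y\<close>.

  Boundedness and variance enter through the monotonicity of \<open>y \<mapsto> (cosh y - 1) / y\<^sup>2\<close> on the
  positive half-line: it bounds \<open>cosh (t X\<^sub>i) - 1\<close> by \<open>(X\<^sub>i / d)\<^sup>2 (cosh (t d) - 1)\<close>, so
  \<open>E cosh (t X\<^sub>i) \<le> 1 + \<gamma> (cosh (t d) - 1)\<close> (\<open>expectation_cosh_X_le\<close>).

  With \<open>x = t d\<close> and \<open>a = \<alpha> n = \<delta> d n\<close> the probability is therefore at most
  \<open>2 (exp (- \<delta> x) (1 + \<gamma> (cosh x - 1)))\<^sup>n\<close> for every \<open>x \<ge> 0\<close> (\<open>prob_exceeds_le\<close>). For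
  \<open>\<delta> < 1\<close> the choice \<open>x = x_opt \<gamma> \<delta>\<close> is a nonnegative tilt (\<open>x_opt_nonneg\<close>) and
  turns the base into \<open>exp (- E (\<gamma>, \<delta>))\<close>. For \<open>\<delta> \<ge> 1\<close> let \<open>x \<rightarrow> \<infinity>\<close>: the base tends to
  \<open>\<gamma> / 2\<close> when \<open>\<delta> = 1\<close> and to \<open>0\<close> when \<open>\<delta> > 1\<close> (\<open>le_rate_if_le_all_tilts\<close>).
\<close>

section \<open>Hyperbolic inequalities\<close>

text \<open>
  The chord of the convex function \<open>sinh\<close> over \<open>[0, v]\<close> starts at the origin; so
  \<open>sinh u / u\<close> is nondecreasing for positive \<open>u\<close>.
\<close>

lemma sinh_mult_le_mult_sinh:
  fixes u v :: real
  assumes "0 \<le> u" "u \<le> v"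
  shows "v * sinh u \<le> u * sinh v"
proof (cases "v = 0")
  case True
  then show ?thesis using assms by simp
next
  case False
  then have v: "v > 0" using assms by simp
  have "convex_on {0..v} (sinh :: real \<Rightarrow> real)"
    by (rule f''_ge0_imp_convex[where f' = cosh and f'' = sinh])
       (auto intro!: derivative_eq_intros)
  from convex_onD_Icc'[OF this, of u] have "sinh u \<le> sinh v / v * u"
    using assms by simp
  then show ?thesis using v by (simp add: field_simps)
qed

text \<open>
  Among random variables \<open>Y\<close> of given second moment with values in \<open>[-c, c]\<close>, the mean of
  \<open>cosh (t Y)\<close> is largest for one supported on \<open>{-c, 0, c}\<close>; this is the pointwise reason. Writing \<open>cosh z - 1\<close> as
  \<open>2 sinh\<^sup>2 (z / 2)\<close> reduces it to the monotonicity of \<open>sinh u / u\<close>.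
\<close>

lemma cosh_minus_one_scale_le:
  fixes t y c :: real
  assumes "\<bar>y\<bar> \<le> c"
  shows "c\<^sup>2 * (cosh (t * y) - 1) \<le> y\<^sup>2 * (cosh (t * c) - 1)"
proof (cases "t = 0")
  case False
  have half: "cosh z - 1 = 2 * (sinh (\<bar>z\<bar> / 2))\<^sup>2" for z :: real
    using cosh_double_cosh[of "\<bar>z\<bar> / 2"] by (simp add: cosh_square_eq)
  have c: "\<bar>c\<bar> = c" using assms by simp
  have "\<bar>t * c\<bar> / 2 * sinh (\<bar>t * y\<bar> / 2) \<le> \<bar>t * y\<bar> / 2 * sinh (\<bar>t * c\<bar> / 2)"
    using assms by (intro sinh_mult_le_mult_sinh) (auto simp: abs_mult mult_left_mono)
  then have "c * sinh (\<bar>t * y\<bar> / 2) \<le> \<bar>y\<bar> * sinh (\<bar>t * c\<bar> / 2)"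
    using False by (simp add: abs_mult c mult.assoc)
  then have "(c * sinh (\<bar>t * y\<bar> / 2))\<^sup>2 \<le> (\<bar>y\<bar> * sinh (\<bar>t * c\<bar> / 2))\<^sup>2"
    using assms by (intro power_mono) auto
  then show ?thesis
    unfolding half[of "t * y"] half[of "t * c"] by (simp add: power_mult_distrib)
qed simp

lemma exp_le_2_cosh: "exp x \<le> 2 * cosh (x :: real)"
  by (simp add: cosh_field_def)

section \<open>A maximal inequality for bounded symmetric random walks\<close>

locale symmetric_walk = prob_space M for M :: "'a measure" +
  fixes X :: "nat \<Rightarrow> 'a \<Rightarrow> real" and c :: real
  assumes indep: "indep_vars (\<lambda>_. borel) X {1..}"
    and bounded: "\<And>i. i \<ge> 1 \<Longrightarrow> AE \<omega> in M. \<bar>X i \<omega>\<bar> \<le> c"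
    and symmetric: "\<And>i. i \<ge> 1 \<Longrightarrow> distr M borel (X i) = distr M borel (\<lambda>\<omega>. - X i \<omega>)"
begin

definition S :: "nat \<Rightarrow> 'a \<Rightarrow> real" where
  "S n \<omega> = (\<Sum>i=1..n. X i \<omega>)"

text \<open>
  The index range includes the starting point \<open>S 0 = 0\<close>. For \<open>a > 0\<close> that adds nothing, and it
  makes the event at level \<open>a = 0\<close> the whole space, so that identities restricted to the event
  specialise to unrestricted ones.
\<close>

definition exceeds :: "real \<Rightarrow> nat \<Rightarrow> 'a set" where
  "exceeds a n = {\<omega> \<in> space M. \<exists>k\<in>{..n}. a \<le> \<bar>S k \<omega>\<bar>}"

lemma measurable_X: "i \<ge> 1 \<Longrightarrow> X i \<in> borel_measurable M"
  using indep by (auto simp: indep_vars_def)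

lemma measurable_S [measurable]: "S n \<in> borel_measurable M"
  unfolding S_def by (intro borel_measurable_sum measurable_X) auto

lemma sets_exceeds [measurable]: "exceeds a n \<in> sets M"
  unfolding exceeds_def by measurable

lemma S_0: "S 0 \<omega> = 0" and S_Suc: "S (Suc n) \<omega> = S n \<omega> + X (Suc n) \<omega>"
  by (simp_all add: S_def)

lemma exceeds_0: "exceeds a 0 = (if a \<le> 0 then space M else {})"
  by (simp add: exceeds_def S_0)

lemma exceeds_level_0: "exceeds 0 n = space M"
  by (auto simp: exceeds_def)

lemma exceeds_Suc:
  "exceeds a (Suc n) = exceeds a n \<union> {\<omega> \<in> space M. a \<le> \<bar>S (Suc n) \<omega>\<bar>}"
  by (auto simp: exceeds_def atMost_Suc)

lemma AE_S_bounded: "AE \<omega> in M. \<bar>S n \<omega>\<bar> \<le> real n * c"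
proof (induction n)
  case (Suc n)
  then show ?case using bounded[of "Suc n"]
    by (auto simp: S_Suc algebra_simps)
qed (simp add: S_0)

lemma integrable_continuous_bounded:
  fixes f :: "real \<Rightarrow> real"
  assumes f: "continuous_on UNIV f" and Y: "Y \<in> borel_measurable M"
    and b: "AE \<omega> in M. \<bar>Y \<omega>\<bar> \<le> b"
  shows "integrable M (\<lambda>\<omega>. f (Y \<omega>))"
proof -
  have "compact (f ` {- b..b})"
    by (intro compact_continuous_image continuous_on_subset[OF f]) auto
  then obtain B where B: "\<And>y. y \<in> {- b..b} \<Longrightarrow> norm (f y) \<le> B"
    using bounded_iff compact_imp_bounded by (metis imageI)
  have "f \<in> borel_measurable borel"
    using f by (rule borel_measurable_continuous_onI)
  then have "(\<lambda>\<omega>. f (Y \<omega>)) \<in> borel_measurable M"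
    using Y by simp
  moreover have "AE \<omega> in M. norm (f (Y \<omega>)) \<le> B"
    using b by eventually_elim (rule B, auto)
  ultimately show ?thesis by (intro integrable_const_bound)
qed

lemma integrable_X:
  fixes f :: "real \<Rightarrow> real"
  assumes "continuous_on UNIV f" "i \<ge> 1"
  shows "integrable M (\<lambda>\<omega>. f (X i \<omega>))"
  using assms by (intro integrable_continuous_bounded[OF _ measurable_X bounded]) auto

lemma integrable_S:
  fixes f :: "real \<Rightarrow> real"
  assumes "continuous_on UNIV f"
  shows "integrable M (\<lambda>\<omega>. f (S n \<omega>))"
  using assms by (intro integrable_continuous_bounded[OF _ measurable_S AE_S_bounded])

lemma expectation_sinh_X:
  assumes "i \<ge> 1"
  shows "expectation (\<lambda>\<omega>. sinh (t * X i \<omega>)) = 0"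
proof -
  have m: "(\<lambda>y. sinh (t * y)) \<in> borel_measurable (borel :: real measure)"
    by (intro borel_measurable_continuous_onI continuous_intros)
  have "expectation (\<lambda>\<omega>. sinh (t * X i \<omega>)) = (\<integral>y. sinh (t * y) \<partial>distr M borel (X i))"
    by (rule integral_distr[OF measurable_X[OF assms] m, symmetric])
  also have "\<dots> = (\<integral>y. sinh (t * y) \<partial>distr M borel (\<lambda>\<omega>. - X i \<omega>))"
    by (simp only: symmetric[OF assms])
  also have "\<dots> = expectation (\<lambda>\<omega>. sinh (t * - X i \<omega>))"
    using measurable_X[OF assms] by (intro integral_distr[OF _ m]) simp
  also have "\<dots> = - expectation (\<lambda>\<omega>. sinh (t * X i \<omega>))"
    by simp
  finally show ?thesis by simp
qed

lemma expectation_cosh_X_ge_1: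
  assumes "i \<ge> 1"
  shows "1 \<le> expectation (\<lambda>\<omega>. cosh (t * X i \<omega>))"
proof -
  have "expectation (\<lambda>_. 1) \<le> expectation (\<lambda>\<omega>. cosh (t * X i \<omega>))"
    using assms
    by (intro integral_mono integrable_X continuous_intros) (auto simp: cosh_real_ge_1)
  then show ?thesis by (simp add: prob_space)
qed

text \<open>
  This is independence of \<open>X (Suc n)\<close> from the past. The set \<open>Q\<close> below expresses \<open>exceeds a n\<close>
  as a condition on the tuple \<open>(X 1, \<dots>, X n)\<close>, so that \<open>f (S n)\<close> times its indicator is a
  measurable function \<open>F\<close> of that tuple.
\<close>

lemma expectation_past_times_next:
  fixes f g :: "real \<Rightarrow> real"
  assumes f: "continuous_on UNIV f" and g: "continuous_on UNIV g"
  shows "integrable M (\<lambda>\<omega>. f (S n \<omega>) * indicator (exceeds a n) \<omega> * g (X (Suc n) \<omega>))" (is ?int)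
    and "expectation (\<lambda>\<omega>. f (S n \<omega>) * indicator (exceeds a n) \<omega> * g (X (Suc n) \<omega>)) =
      expectation (\<lambda>\<omega>. f (S n \<omega>) * indicator (exceeds a n) \<omega>) * expectation (\<lambda>\<omega>. g (X (Suc n) \<omega>))"
      (is ?eq)
proof -
  define P where "P = PiM {1..n} (\<lambda>_. borel :: real measure)"
  define N where "N = PiM {Suc n} (\<lambda>_. borel :: real measure)"
  define Q where "Q = {x \<in> space P. \<exists>k\<in>{..n}. a \<le> \<bar>\<Sum>i=1..k. x i\<bar>}"
  define F where "F x = f (\<Sum>i=1..n. x i) * indicator Q x" for x
  define R where "R \<omega> = restrict (\<lambda>i. X i \<omega>) {1..n}" for \<omega>
  have sums [measurable]: "(\<lambda>x. \<Sum>i=1..k. x i) \<in> borel_measurable P" if "k \<le> n" for k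
    unfolding P_def using that
    by (intro borel_measurable_sum measurable_component_singleton) auto
  have "Q \<in> sets P"
    unfolding Q_def
    by (intro sets.sets_Collect_finite_Ex borel_measurable_le borel_measurable_abs sums) auto
  moreover have "f \<in> borel_measurable borel" "g \<in> borel_measurable borel"
    using f g by (auto intro: borel_measurable_continuous_onI)
  ultimately have F: "F \<in> borel_measurable P" and
      G: "(\<lambda>x. g (x (Suc n))) \<in> borel_measurable N"
    unfolding F_def N_def using sums[of n]
    by (auto intro!: borel_measurable_times measurable_compose[of _ P borel f]
          measurable_compose[of _ _ borel g] borel_measurable_indicator)
  have "indep_var P R N (\<lambda>\<omega>. restrict (\<lambda>i. X i \<omega>) {Suc n})"
    unfolding P_def N_def R_def by (intro indep_var_restrict[OF indep]) auto
  from indep_var_compose[OF this F G]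
  have ind: "indep_var borel (\<lambda>\<omega>. F (R \<omega>)) borel (\<lambda>\<omega>. g (X (Suc n) \<omega>))"
    by (simp add: comp_def)
  have FR: "F (R \<omega>) = f (S n \<omega>) * indicator (exceeds a n) \<omega>" if "\<omega> \<in> space M" for \<omega>
  proof -
    have *: "(\<Sum>i=1..k. R \<omega> i) = S k \<omega>" if "k \<le> n" for k
      unfolding S_def R_def using that by (intro sum.cong) auto
    have "R \<omega> \<in> Q \<longleftrightarrow> \<omega> \<in> exceeds a n"
      using that * by (auto simp: Q_def P_def exceeds_def space_PiM R_def)
    then show ?thesis using *[of n] by (simp add: F_def indicator_def)
  qed
  have past: "integrable M (\<lambda>\<omega>. F (R \<omega>))"
  proof -
    have "integrable M (\<lambda>\<omega>. f (S n \<omega>) * indicator (exceeds a n) \<omega>)"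
      by (intro integrable_real_mult_indicator integrable_S f) simp
    then show ?thesis using FR by (simp cong: Bochner_Integration.integrable_cong)
  qed
  have nxt: "integrable M (\<lambda>\<omega>. g (X (Suc n) \<omega>))"
    by (intro integrable_X g) simp
  show ?int
    using indep_var_integrable[OF ind past nxt] FR
    by (simp cong: Bochner_Integration.integrable_cong)
  show ?eq
    using indep_var_lebesgue_integral[OF ind past nxt] FR
    by (simp cong: Bochner_Integration.integral_cong)
qed

text \<open>
  In the addition theorem for \<open>cosh\<close> the product of the two \<open>sinh\<close> factors integrates to \<open>0\<close>,
  because the increment is symmetric and independent of the past.
\<close>

lemma expectation_cosh_S_past:
  "expectation (\<lambda>\<omega>. cosh (t * S (Suc n) \<omega>) * indicator (exceeds a n) \<omega>) =
   expectation (\<lambda>\<omega>. cosh (t * S n \<omega>) * indicator (exceeds a n) \<omega>) *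
   expectation (\<lambda>\<omega>. cosh (t * X (Suc n) \<omega>))"
proof -
  have c: "continuous_on UNIV (\<lambda>y. cosh (t * y))" and s: "continuous_on UNIV (\<lambda>y. sinh (t * y))"
    by (intro continuous_intros)+
  have "(\<lambda>\<omega>. cosh (t * S (Suc n) \<omega>) * indicator (exceeds a n) \<omega>) =
     (\<lambda>\<omega>. cosh (t * S n \<omega>) * indicator (exceeds a n) \<omega> * cosh (t * X (Suc n) \<omega>) +
          sinh (t * S n \<omega>) * indicator (exceeds a n) \<omega> * sinh (t * X (Suc n) \<omega>))"
    by (simp add: S_Suc distrib_left cosh_add fun_eq_iff algebra_simps)
  then show ?thesis
    using expectation_past_times_next[OF c c, of n a] expectation_past_times_next[OF s s, of n a]
    by (simp add: expectation_sinh_X)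
qed

text \<open>
  Doob's maximal inequality for \<open>cosh (t S)\<close>, by induction on time. On the part of the event that
  has already occurred, one more step can only increase the mean of \<open>cosh (t S)\<close>; on the part that
  occurs at the new step, \<open>cosh (t S)\<close> is at least \<open>cosh (t a)\<close> pointwise.
\<close>

lemma maximal_inequality_cosh:
  assumes "0 \<le> t" "0 \<le> a"
  shows "prob (exceeds a n) * cosh (t * a) \<le>
    expectation (\<lambda>\<omega>. cosh (t * S n \<omega>) * indicator (exceeds a n) \<omega>)"
proof (induction n)
  case 0
  then show ?case using assms by (auto simp: exceeds_0 S_0)
next
  case (Suc n)
  let ?C = "\<lambda>n \<omega>. cosh (t * S n \<omega>)"
  let ?D = "exceeds a (Suc n) - exceeds a n"
  have int: "integrable M (\<lambda>\<omega>. ?C m \<omega> * indicator A \<omega>)" if "A \<in> sets M" for m A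
    using that by (intro integrable_real_mult_indicator integrable_S continuous_intros)
  have nonneg: "0 \<le> expectation (\<lambda>\<omega>. ?C n \<omega> * indicator (exceeds a n) \<omega>)"
    by (intro Bochner_Integration.integral_nonneg) (auto simp: indicator_def)
  have "prob (exceeds a n) * cosh (t * a) \<le> expectation (\<lambda>\<omega>. ?C n \<omega> * indicator (exceeds a n) \<omega>)"
    by (rule Suc.IH)
  also have "\<dots> \<le> \<dots> * expectation (\<lambda>\<omega>. cosh (t * X (Suc n) \<omega>))"
    using expectation_cosh_X_ge_1[of "Suc n" t] by (simp add: mult_le_cancel_left1 leD nonneg)
  also have "\<dots> = expectation (\<lambda>\<omega>. ?C (Suc n) \<omega> * indicator (exceeds a n) \<omega>)"
    by (rule expectation_cosh_S_past[symmetric])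
  finally have old: "prob (exceeds a n) * cosh (t * a) \<le>
      expectation (\<lambda>\<omega>. ?C (Suc n) \<omega> * indicator (exceeds a n) \<omega>)" .
  have "cosh (t * a) \<le> ?C (Suc n) \<omega>" if "\<omega> \<in> ?D" for \<omega>
  proof -
    have "a \<le> \<bar>S (Suc n) \<omega>\<bar>" using that by (auto simp: exceeds_Suc)
    then have "cosh (t * a) \<le> cosh \<bar>t * S (Suc n) \<omega>\<bar>"
      using assms by (subst cosh_real_nonneg_le_iff) (auto simp: abs_mult mult_left_mono)
    then show ?thesis by simp
  qed
  moreover have "integrable M (\<lambda>\<omega>. cosh (t * a) * indicator ?D \<omega>)"
    by (intro integrable_real_mult_indicator) auto
  ultimately have "expectation (\<lambda>\<omega>. cosh (t * a) * indicator ?D \<omega>) \<le>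
      expectation (\<lambda>\<omega>. ?C (Suc n) \<omega> * indicator ?D \<omega>)"
    by (intro integral_mono int) (auto simp: indicator_def)
  then have new: "prob ?D * cosh (t * a) \<le> expectation (\<lambda>\<omega>. ?C (Suc n) \<omega> * indicator ?D \<omega>)"
    by (simp add: mult.commute)
  have sub: "exceeds a n \<subseteq> exceeds a (Suc n)" by (simp add: exceeds_Suc)
  have "prob (exceeds a (Suc n)) = prob (exceeds a n) + prob ?D"
    using finite_measure_Diff[OF sets_exceeds sets_exceeds sub] by simp
  moreover have "expectation (\<lambda>\<omega>. ?C (Suc n) \<omega> * indicator (exceeds a (Suc n)) \<omega>) =
      expectation (\<lambda>\<omega>. ?C (Suc n) \<omega> * indicator (exceeds a n) \<omega>) +
      expectation (\<lambda>\<omega>. ?C (Suc n) \<omega> * indicator ?D \<omega>)"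
    using sub
    by (subst Bochner_Integration.integral_add[OF int int, symmetric])
       (auto intro!: Bochner_Integration.integral_cong simp: indicator_def)
  ultimately show ?case using old new by (simp add: algebra_simps)
qed

text \<open>
  The one-step identity at level \<open>0\<close>, where the event is the whole space, telescopes to a product.
\<close>

lemma expectation_cosh_S:
  "expectation (\<lambda>\<omega>. cosh (t * S n \<omega>)) = (\<Prod>i=1..n. expectation (\<lambda>\<omega>. cosh (t * X i \<omega>)))"
proof (induction n)
  case 0
  then show ?case by (simp add: S_0 prob_space)
next
  case (Suc n)
  have whole: "expectation (\<lambda>\<omega>. cosh (t * S m \<omega>) * indicator (space M) \<omega>) =
      expectation (\<lambda>\<omega>. cosh (t * S m \<omega>))" for m
    by (intro Bochner_Integration.integral_cong) auto
  show ?case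
    using expectation_cosh_S_past[of t n 0] Suc.IH by (simp add: exceeds_level_0 whole)
qed

lemma expectation_cosh_X_le:
  assumes "0 < c" "i \<ge> 1" and var: "expectation (\<lambda>\<omega>. (X i \<omega>)\<^sup>2) \<le> \<gamma> * c\<^sup>2"
  shows "expectation (\<lambda>\<omega>. cosh (t * X i \<omega>)) \<le> 1 + \<gamma> * (cosh (t * c) - 1)"
proof -
  define K where "K = (cosh (t * c) - 1) / c\<^sup>2"
  have K: "0 \<le> K" unfolding K_def by (simp add: cosh_real_ge_1)
  have sq: "integrable M (\<lambda>\<omega>. (X i \<omega>)\<^sup>2)"
    using assms by (intro integrable_X continuous_intros)
  have "AE \<omega> in M. cosh (t * X i \<omega>) \<le> 1 + K * (X i \<omega>)\<^sup>2"
    using bounded[OF \<open>i \<ge> 1\<close>]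
  proof eventually_elim
    case (elim \<omega>)
    then show ?case
      using cosh_minus_one_scale_le[OF elim, of t] \<open>0 < c\<close> by (simp add: K_def field_simps)
  qed
  then have "expectation (\<lambda>\<omega>. cosh (t * X i \<omega>)) \<le> expectation (\<lambda>\<omega>. 1 + K * (X i \<omega>)\<^sup>2)"
    using sq assms by (intro integral_mono_AE integrable_X continuous_intros) auto
  also have "\<dots> = 1 + K * expectation (\<lambda>\<omega>. (X i \<omega>)\<^sup>2)"
    using sq by (simp add: prob_space)
  also have "\<dots> \<le> 1 + K * (\<gamma> * c\<^sup>2)"
    using var K by (simp add: mult_left_mono)
  also have "\<dots> = 1 + \<gamma> * (cosh (t * c) - 1)"
    using \<open>0 < c\<close> by (simp add: K_def)
  finally show ?thesis .
qed

text \<open>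
  The maximal inequality at \<open>t = x / c\<close> with \<open>cosh\<close> replaced by half an exponential: the Chernoff
  bound at tilt \<open>x\<close> for the threshold \<open>\<delta> c n\<close>.
\<close>

lemma prob_exceeds_le:
  assumes "0 < c" "0 \<le> x" "0 \<le> \<delta>"
    and var: "\<And>i. i \<ge> 1 \<Longrightarrow> expectation (\<lambda>\<omega>. (X i \<omega>)\<^sup>2) \<le> \<gamma> * c\<^sup>2"
  shows "prob (exceeds (\<delta> * c * real n) n) \<le> 2 * (exp (- \<delta> * x) * (1 + \<gamma> * (cosh x - 1))) ^ n"
proof -
  define t where "t = x / c"
  let ?a = "\<delta> * c * real n" and ?L = "1 + \<gamma> * (cosh x - 1)"
  have tc: "t * c = x" and ta: "t * ?a = real n * (\<delta> * x)"
    using assms by (auto simp: t_def)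
  have int: "integrable M (\<lambda>\<omega>. cosh (t * S n \<omega>))"
    by (intro integrable_S continuous_intros)
  have "prob (exceeds ?a n) * cosh (t * ?a) \<le>
      expectation (\<lambda>\<omega>. cosh (t * S n \<omega>) * indicator (exceeds ?a n) \<omega>)"
    using assms by (intro maximal_inequality_cosh) (auto simp: t_def)
  also have "\<dots> \<le> expectation (\<lambda>\<omega>. cosh (t * S n \<omega>))"
    by (intro integral_mono integrable_real_mult_indicator int) (auto simp: indicator_def)
  also have "\<dots> = (\<Prod>i=1..n. expectation (\<lambda>\<omega>. cosh (t * X i \<omega>)))"
    by (rule expectation_cosh_S)
  also have "\<dots> \<le> (\<Prod>i=1..n. ?L)"
    using expectation_cosh_X_le[OF \<open>0 < c\<close> _ var, of _ t] tc
    by (intro prod_mono) (auto intro!: Bochner_Integration.integral_nonneg)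
  finally have "prob (exceeds ?a n) * cosh (t * ?a) \<le> ?L ^ n" by simp
  moreover have "prob (exceeds ?a n) * exp (t * ?a) \<le> prob (exceeds ?a n) * (2 * cosh (t * ?a))"
    by (intro mult_left_mono exp_le_2_cosh) simp
  ultimately have "prob (exceeds ?a n) * exp (t * ?a) \<le> 2 * ?L ^ n" by simp
  then have "exp (- (t * ?a)) * (prob (exceeds ?a n) * exp (t * ?a)) \<le> exp (- (t * ?a)) * (2 * ?L ^ n)"
    by (intro mult_left_mono) auto
  moreover have "exp (- (t * ?a)) = exp (- \<delta> * x) ^ n"
    unfolding ta by (simp flip: exp_of_nat_mult)
  ultimately show ?thesis
    by (simp add: power_mult_distrib exp_minus field_simps)
qed

end

section \<open>The rate function\<close>

text \<open>
  The Chernoff bound is available at nonnegative tilts only. Dropping the first summand under the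
  root and using \<open>1 - \<delta>\<^sup>2 \<ge> (1 - \<delta>)\<^sup>2\<close>, the root alone is at least the denominator
  \<open>\<gamma> (1 - \<delta>)\<close>, so the argument of the logarithm is at least \<open>1\<close>.
\<close>

lemma x_opt_nonneg:
  assumes "0 < \<gamma>" "\<gamma> \<le> 1" "0 \<le> \<delta>" "\<delta> < 1"
  shows "0 \<le> x_opt \<gamma> \<delta>"
proof -
  have "(1 - \<delta>)\<^sup>2 \<le> 1 - \<delta>\<^sup>2"
    using mult_nonneg_nonneg[of \<delta> "1 - \<delta>"] assms by (simp add: power2_eq_square algebra_simps)
  then have "(\<gamma> * (1 - \<delta>))\<^sup>2 \<le> \<delta>\<^sup>2 * (1 - \<gamma>)\<^sup>2 + \<gamma>\<^sup>2 * (1 - \<delta>\<^sup>2)"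
    by (simp add: power_mult_distrib mult_left_mono add_increasing)
  then have "\<gamma> * (1 - \<delta>) \<le> sqrt (\<delta>\<^sup>2 * (1 - \<gamma>)\<^sup>2 + \<gamma>\<^sup>2 * (1 - \<delta>\<^sup>2))"
    by (rule real_le_rsqrt)
  moreover have "0 \<le> \<delta> * (1 - \<gamma>)" "0 < \<gamma> * (1 - \<delta>)"
    using assms by auto
  ultimately show ?thesis
    unfolding x_opt_def by (intro ln_ge_zero) (simp add: le_divide_eq)
qed

lemma tendsto_exp_mult_at_top_0:
  fixes k :: real
  assumes "k < 0"
  shows "((\<lambda>x. exp (k * x)) \<longlongrightarrow> 0) at_top"
  by (rule filterlim_compose[OF exp_at_bot
      filterlim_tendsto_neg_mult_at_bot[OF tendsto_const assms filterlim_ident]])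

text \<open>
  In this form the behaviour for large \<open>x\<close> is visible: only \<open>exp ((1 - \<delta>) x)\<close> can fail to vanish
  when \<open>\<delta> \<ge> 1\<close>.
\<close>

lemma tilted_cosh_expand:
  fixes \<delta> \<gamma> x :: real
  shows "exp (- \<delta> * x) * (1 + \<gamma> * (cosh x - 1)) =
    (1 - \<gamma>) * exp (- \<delta> * x) + \<gamma> / 2 * (exp ((1 - \<delta>) * x) + exp (- (1 + \<delta>) * x))"
  by (simp add: cosh_field_def algebra_simps flip: exp_add)

lemma tilted_cosh_limit_1:
  "((\<lambda>x::real. exp (- 1 * x) * (1 + \<gamma> * (cosh x - 1))) \<longlongrightarrow> \<gamma> / 2) at_top"
proof -
  have "((\<lambda>x. (1 - \<gamma>) * exp (- 1 * x) + \<gamma> / 2 * (exp ((1 - 1) * x) + exp (- (1 + 1) * x)))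
      \<longlongrightarrow> (1 - \<gamma>) * 0 + \<gamma> / 2 * (1 + 0)) at_top"
    by (intro tendsto_intros tendsto_exp_mult_at_top_0) auto
  then show ?thesis unfolding tilted_cosh_expand by simp
qed

lemma tilted_cosh_limit_gt_1:
  assumes "1 < \<delta>"
  shows "((\<lambda>x::real. exp (- \<delta> * x) * (1 + \<gamma> * (cosh x - 1))) \<longlongrightarrow> 0) at_top"
proof -
  have "((\<lambda>x. (1 - \<gamma>) * exp (- \<delta> * x) + \<gamma> / 2 * (exp ((1 - \<delta>) * x) + exp (- (1 + \<delta>) * x)))
      \<longlongrightarrow> (1 - \<gamma>) * 0 + \<gamma> / 2 * (0 + 0)) at_top"
    using assms by (intro tendsto_intros tendsto_exp_mult_at_top_0) auto
  then show ?thesis unfolding tilted_cosh_expand by simp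
qed

text \<open>
  The infimum of the Chernoff bounds over all tilts \<open>x \<ge> 0\<close> is the rate bound. It is attained at
  \<open>x_opt \<gamma> \<delta>\<close> when \<open>\<delta> < 1\<close>, and approached only as \<open>x \<rightarrow> \<infinity>\<close> when \<open>\<delta> \<ge> 1\<close>.
  The hypothesis \<open>n \<ge> 1\<close> makes the limiting bound \<open>2 0\<^sup>n\<close> vanish in the case \<open>\<delta> > 1\<close>.
\<close>

lemma le_rate_if_le_all_tilts:
  fixes p :: real
  assumes \<gamma>: "0 < \<gamma>" "\<gamma> \<le> 1" and \<delta>: "0 \<le> \<delta>" and n: "n \<ge> 1"
    and bound: "\<And>x. 0 \<le> x \<Longrightarrow> p \<le> 2 * (exp (- \<delta> * x) * (1 + \<gamma> * (cosh x - 1))) ^ n"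
  shows "ereal p \<le> 2 * exp_ereal (- (ereal (real n) * rate_E \<gamma> \<delta>))"
proof -
  define h where "h x = exp (- \<delta> * x) * (1 + \<gamma> * (cosh x - 1))" for x
  have limit: "p \<le> 2 * l ^ n" if "(h \<longlongrightarrow> l) at_top" for l
  proof (rule tendsto_lowerbound)
    show "((\<lambda>x. 2 * h x ^ n) \<longlongrightarrow> 2 * l ^ n) at_top"
      by (intro tendsto_intros that)
    show "\<forall>\<^sub>F x in at_top. p \<le> 2 * h x ^ n"
      using eventually_ge_at_top[of 0] by eventually_elim (use bound in \<open>auto simp: h_def\<close>)
  qed simp
  consider "\<delta> < 1" | "\<delta> = 1" | "\<delta> > 1" by linarith
  then show ?thesis
  proof cases
    case 1
    define x where "x = x_opt \<gamma> \<delta>"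
    have "0 \<le> \<gamma> * (cosh x - 1)"
      using \<gamma> by (simp add: cosh_real_ge_1)
    then have "h x = exp (- (\<delta> * x - ln (1 + \<gamma> * (cosh x - 1))))"
      by (simp add: h_def exp_add exp_diff exp_minus field_simps)
    then have "h x ^ n = exp (- (real n * (\<delta> * x - ln (1 + \<gamma> * (cosh x - 1)))))"
      by (simp add: algebra_simps flip: exp_of_nat_mult)
    moreover have "p \<le> 2 * h x ^ n"
      using bound[of x] x_opt_nonneg[OF \<gamma> \<delta> 1] by (simp add: h_def x_def)
    ultimately show ?thesis
      using 1 by (simp add: rate_E_def exp_ereal_def x_def)
  next
    case 2
    have "p \<le> 2 * (\<gamma> / 2) ^ n"
      using limit tilted_cosh_limit_1[of \<gamma>] 2 by (simp add: h_def[abs_def])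
    also have "(\<gamma> / 2) ^ n = exp (- (real n * ln (2 / \<gamma>)))"
    proof -
      have "\<gamma> / 2 = exp (- ln (2 / \<gamma>))" using \<gamma> by (simp add: exp_minus)
      then have "(\<gamma> / 2) ^ n = exp (- ln (2 / \<gamma>)) ^ n" by (rule arg_cong)
      then show ?thesis by (simp flip: exp_of_nat_mult)
    qed
    finally show ?thesis
      using 2 by (simp add: rate_E_def exp_ereal_def)
  next
    case 3
    have "p \<le> 2 * 0 ^ n"
      using tilted_cosh_limit_gt_1[OF 3, of \<gamma>] by (intro limit) (simp add: h_def[abs_def])
    then show ?thesis
      using 3 n by (simp add: rate_E_def exp_ereal_def power_0_left)
  qed
qed

section \<open>The exponential bound for the maximal deviation\<close>

theorem corollary1:
  fixes M :: "'a measure" and U :: "nat \<Rightarrow> 'a \<Rightarrow> real"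
    and d \<gamma> \<alpha> :: real and n :: nat
  assumes "prob_space M"
    and "prob_space.indep_vars M (\<lambda>_. borel) U {1..}"
    and "\<And>k. k \<ge> 1 \<Longrightarrow> distr M borel (U k) = distr M borel (U 1)"
    and "\<exists>B. \<forall>k\<ge>1. AE \<omega> in M. \<bar>U k \<omega>\<bar> \<le> B"
    and "\<And>k. k \<ge> 1 \<Longrightarrow> integrable M (\<lambda>\<omega>. (U k \<omega>)\<^sup>2)"
    and "\<And>k. k \<ge> 1 \<Longrightarrow> symmetric_around_mean M (U k)"
    and "d > 0"
    and "AE \<omega> in M. \<bar>U 1 \<omega> - prob_space.expectation M (U 1)\<bar> \<le> d"
    and "0 < \<gamma>" and "\<gamma> \<le> 1"
    and "prob_space.variance M (U 1) \<le> \<gamma> * d\<^sup>2"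
    and "\<alpha> \<ge> 0"
    and "n \<ge> 1"
  shows "ereal (prob_space.prob M {\<omega> \<in> space M.
            (MAX k\<in>{1..n}. \<bar>(\<Sum>i=1..k. U i \<omega>) - real k * prob_space.expectation M (U 1)\<bar>)
              \<ge> \<alpha> * real n})
         \<le> 2 * exp_ereal (- (ereal (real n) * rate_E \<gamma> (\<alpha> / d)))"
proof -
  interpret prob_space M by fact
  define m where "m = expectation (U 1)"
  define X where "X i \<omega> = U i \<omega> - m" for i \<omega>
  have U [measurable]: "U i \<in> borel_measurable M" if "i \<ge> 1" for i
    using assms(2) that by (auto simp: indep_vars_def)
  \<comment> \<open>The bounds by \<open>d\<close> and \<open>\<gamma> d\<^sup>2\<close> are given for \<open>U 1\<close>; equality in law moves them to all \<open>U i\<close>.\<close>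
  have transfer: "expectation (\<lambda>\<omega>. f (U i \<omega>)) = expectation (\<lambda>\<omega>. f (U 1 \<omega>))"
    if "i \<ge> 1" "f \<in> borel_measurable borel" for i and f :: "real \<Rightarrow> real"
    using integral_distr[OF U[OF that(1)] that(2)] integral_distr[OF U[of 1] that(2)]
      assms(3)[OF that(1)] by simp
  have mean: "expectation (U i) = m" if "i \<ge> 1" for i
    using transfer[OF that, of "\<lambda>y. y"] by (simp add: m_def)
  interpret symmetric_walk M X d
  proof
    show "indep_vars (\<lambda>_. borel) X {1..}"
      using indep_vars_compose2[OF assms(2), of "\<lambda>_ y. y - m" "\<lambda>_. borel"]
      by (simp add: X_def[abs_def])
    fix i :: nat assume i: "i \<ge> 1"
    have "AE y in distr M borel (U 1). \<bar>y - m\<bar> \<le> d"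
      using assms(8) by (subst AE_distr_iff) (auto simp: m_def)
    then have "AE y in distr M borel (U i). \<bar>y - m\<bar> \<le> d"
      by (simp only: assms(3)[OF i])
    then show "AE \<omega> in M. \<bar>X i \<omega>\<bar> \<le> d"
      using U[OF i] by (subst (asm) AE_distr_iff) (auto simp: X_def)
    show "distr M borel (X i) = distr M borel (\<lambda>\<omega>. - X i \<omega>)"
      using assms(6)[OF i] mean[OF i] by (simp add: symmetric_around_mean_def X_def[abs_def])
  qed
  have var: "expectation (\<lambda>\<omega>. (X i \<omega>)\<^sup>2) \<le> \<gamma> * d\<^sup>2" if "i \<ge> 1" for i
    using transfer[OF that, of "\<lambda>y. (y - m)\<^sup>2"] assms(11) by (simp add: X_def m_def)
  have walk: "(\<Sum>i=1..k. U i \<omega>) - real k * m = S k \<omega>" for k \<omega>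
    by (simp add: S_def X_def sum_subtractf)
  let ?A = "{\<omega> \<in> space M. (MAX k\<in>{1..n}. \<bar>S k \<omega>\<bar>) \<ge> \<alpha> * real n}"
  have "?A \<subseteq> exceeds (\<alpha> * real n) n"
    using assms(13) by (auto simp: exceeds_def Max_ge_iff)
  then have "prob ?A \<le> prob (exceeds (\<alpha> / d * d * real n) n)"
    using assms(7) by (intro finite_measure_mono) auto
  then have "prob ?A \<le> 2 * (exp (- (\<alpha> / d) * x) * (1 + \<gamma> * (cosh x - 1))) ^ n" if "0 \<le> x" for x
    using prob_exceeds_le[OF assms(7) that _ var, of "\<alpha> / d" n] assms(7,12) by simp
  then have "ereal (prob ?A) \<le> 2 * exp_ereal (- (ereal (real n) * rate_E \<gamma> (\<alpha> / d)))"
    using assms by (intro le_rate_if_le_all_tilts) auto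
  then show ?thesis
    unfolding m_def[symmetric] walk .
qed

end
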